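(* Let $L>1$ be fixed. If there exists $\beta_0\in[0,\pi/2)$ such that the function $\beta\mapsto F_L[\beta]$ is continuous on $[\beta_0,\pi/2]$, then for every $\varepsilon\in(0,1]$ there exists $\beta\in[\beta_0,\pi/2)$ such that $F_L[\beta]>1-\varepsilon$.
   Context: Let $\mathbb{K}\in\{\mathbb{R},\mathbb{C}\}$ and $R\ge1$. $\|\cdot\|$ is the Frobenius norm. The rank of a tensor is the least number of rank-1 tensors (outer products of vectors) summing to it. $\phi$ is a best rank-1 approximation operator: $\phi(\mathcal{Y})$ minimizes $\|\mathcal{Y}-\mathcal{Z}\|$ over tensors $\mathcal{Z}$ of rank at most 1. DCPD algorithm with input $\mathcal{T}\in\mathbb{K}^{I_1\times\cdots\times I_N}$ and rank parameter $R$. Initialization: $\mathcal{Y}[1,1]=\mathcal{T}$; for $r=1,\dots,R$ set $\mathcal{X}[r,1]=\phi(\mathcal{Y}[r,1])$, and $\mathcal{Y}[r+1,1]=\mathcal{Y}[r,1]-\mathcal{X}[r,1]$ if $r<R$; $\mathcal{E}[R,1]=\mathcal{Y}[R,1]-\mathcal{X}[R,1]$. For $l\ge2$ and successively $r=1,\dots,R$: $\mathcal{Y}[1,l]=\mathcal{X}[1,l-1]+\mathcal{E}[R,l-1]$, and $\mathcal{Y}[r,l]=\mathcal{X}[r,l-1]+\mathcal{E}[r-1,l]$ if $r>1$; then $\mathcal{X}[r,l]=\phi(\mathcal{Y}[r,l])$ and $\mathcal{E}[r,l]=\mathcal{Y}[r,l]-\mathcal{X}[r,l]$. The input $\mathcal{T}$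 is random, distributed according to a probability measure on the set of tensors of rank at most $R$ (in the paper's setting, an absolutely continuous one; the reference measure is not specified), and the residual norms $Z_l=\|\mathcal{E}[R,l]\|$, $l\ge1$, are regarded as random variables. For $L>1$ and $\beta\in[0,\pi/2]$, $$F_L[\beta]=P\Big(Z_L\le\sin(\beta)Z_{L-1}\le\cdots\le(\sin\beta)^{L-1}Z_1\Big),$$ i.e. the probability that $(\sin\beta)^{L-l}Z_l\le(\sin\beta)^{L-l+1}Z_{l-1}$ for all $2\le l\le L$. *)

theory Defs
  imports "HOL-Probability.Probability"
begin

(* The scalar field is a type of class {real_normed_field, euclidean_space}. Both real and
   complex are instances and, by Frobenius' theorem, there are no others up to isometric
   isomorphism. *)

(* Modes are numbered 1..N and mode n has index range 1..I n. *)
definition multi_indices :: "nat \<Rightarrow> (nat \<Rightarrow> nat) \<Rightarrow> (nat \<Rightarrow> nat) set" where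
  "multi_indices N I = (\<Pi>\<^sub>E n\<in>{1..N}. {1..I n})"

(* Extensional functions, so that this is also the space of the product sigma-algebra
   PiM (multi_indices N I) (\<lambda>_. borel), i.e. of the Borel sets of tensors. *)
definition tensors :: "nat \<Rightarrow> (nat \<Rightarrow> nat) \<Rightarrow> ((nat \<Rightarrow> nat) \<Rightarrow> 'k) set" where
  "tensors N I = (multi_indices N I \<rightarrow>\<^sub>E UNIV)"

definition tensor_add ::
  "nat \<Rightarrow> (nat \<Rightarrow> nat) \<Rightarrow> ((nat \<Rightarrow> nat) \<Rightarrow> 'k) \<Rightarrow> ((nat \<Rightarrow> nat) \<Rightarrow> 'k)
    \<Rightarrow> (nat \<Rightarrow> nat) \<Rightarrow> 'k::plus" where
  "tensor_add N I A B = (\<lambda>i\<in>multi_indices N I. A i + B i)"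

definition tensor_diff ::
  "nat \<Rightarrow> (nat \<Rightarrow> nat) \<Rightarrow> ((nat \<Rightarrow> nat) \<Rightarrow> 'k) \<Rightarrow> ((nat \<Rightarrow> nat) \<Rightarrow> 'k)
    \<Rightarrow> (nat \<Rightarrow> nat) \<Rightarrow> 'k::minus" where
  "tensor_diff N I A B = (\<lambda>i\<in>multi_indices N I. A i - B i)"

definition frob_norm ::
  "nat \<Rightarrow> (nat \<Rightarrow> nat) \<Rightarrow> ((nat \<Rightarrow> nat) \<Rightarrow> 'k::real_normed_vector) \<Rightarrow> real" where
  "frob_norm N I A = L2_set (\<lambda>i. norm (A i)) (multi_indices N I)"

(* v n is the vector of mode n; only its entries 1..I n are used. *)
definition outer_product ::
  "nat \<Rightarrow> (nat \<Rightarrow> nat) \<Rightarrow> (nat \<Rightarrow> nat \<Rightarrow> 'k::comm_monoid_mult) \<Rightarrow> (nat \<Rightarrow> nat) \<Rightarrow> 'k" where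
  "outer_product N I v = (\<lambda>i\<in>multi_indices N I. \<Prod>n\<in>{1..N}. v n (i n))"

(* Zero vectors are admitted in the outer products; this does not change the rank, since the
   zero tensor is already the empty sum. *)
definition tensor_rank ::
  "nat \<Rightarrow> (nat \<Rightarrow> nat) \<Rightarrow> ((nat \<Rightarrow> nat) \<Rightarrow> 'k::comm_semiring_1) \<Rightarrow> nat" where
  "tensor_rank N I A =
     (LEAST k. \<exists>v. A = (\<lambda>i\<in>multi_indices N I. \<Sum>j<k. outer_product N I (v j) i))"

definition rank_at_most ::
  "nat \<Rightarrow> (nat \<Rightarrow> nat) \<Rightarrow> nat \<Rightarrow> ((nat \<Rightarrow> nat) \<Rightarrow> 'k::comm_semiring_1) set" where
  "rank_at_most N I r = {A \<in> tensors N I. tensor_rank N I A \<le> r}"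

definition best_rank1_approx ::
  "nat \<Rightarrow> (nat \<Rightarrow> nat)
    \<Rightarrow> (((nat \<Rightarrow> nat) \<Rightarrow> 'k::real_normed_field) \<Rightarrow> ((nat \<Rightarrow> nat) \<Rightarrow> 'k)) \<Rightarrow> bool" where
  "best_rank1_approx N I \<phi> \<longleftrightarrow>
     (\<forall>Y\<in>tensors N I. \<phi> Y \<in> rank_at_most N I 1 \<and>
        (\<forall>Z\<in>rank_at_most N I 1.
           frob_norm N I (tensor_diff N I Y (\<phi> Y)) \<le> frob_norm N I (tensor_diff N I Y Z)))"

(* The arguments r and l of the iterates are counted from 1; the value 0 is treated as 1.
   The algorithm only produces E[r,1] for r = R; the values for r < R are never used. *)
function
  dcpd_Y :: "nat \<Rightarrow> (nat \<Rightarrow> nat)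
    \<Rightarrow> (((nat \<Rightarrow> nat) \<Rightarrow> 'k::real_normed_field) \<Rightarrow> ((nat \<Rightarrow> nat) \<Rightarrow> 'k))
    \<Rightarrow> nat \<Rightarrow> ((nat \<Rightarrow> nat) \<Rightarrow> 'k) \<Rightarrow> nat \<Rightarrow> nat \<Rightarrow> (nat \<Rightarrow> nat) \<Rightarrow> 'k"
and
  dcpd_X :: "nat \<Rightarrow> (nat \<Rightarrow> nat)
    \<Rightarrow> (((nat \<Rightarrow> nat) \<Rightarrow> 'k::real_normed_field) \<Rightarrow> ((nat \<Rightarrow> nat) \<Rightarrow> 'k))
    \<Rightarrow> nat \<Rightarrow> ((nat \<Rightarrow> nat) \<Rightarrow> 'k) \<Rightarrow> nat \<Rightarrow> nat \<Rightarrow> (nat \<Rightarrow> nat) \<Rightarrow> 'k"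
and
  dcpd_E :: "nat \<Rightarrow> (nat \<Rightarrow> nat)
    \<Rightarrow> (((nat \<Rightarrow> nat) \<Rightarrow> 'k::real_normed_field) \<Rightarrow> ((nat \<Rightarrow> nat) \<Rightarrow> 'k))
    \<Rightarrow> nat \<Rightarrow> ((nat \<Rightarrow> nat) \<Rightarrow> 'k) \<Rightarrow> nat \<Rightarrow> nat \<Rightarrow> (nat \<Rightarrow> nat) \<Rightarrow> 'k"
where
  "dcpd_Y N I \<phi> R T r l =
     (if l \<le> 1 then
        if r \<le> 1 then T
        else tensor_diff N I (dcpd_Y N I \<phi> R T (r - 1) l) (dcpd_X N I \<phi> R T (r - 1) l)
      else
        if r \<le> 1 then tensor_add N I (dcpd_X N I \<phi> R T r (l - 1)) (dcpd_E N I \<phi> R T R (l - 1))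
        else tensor_add N I (dcpd_X N I \<phi> R T r (l - 1)) (dcpd_E N I \<phi> R T (r - 1) l))"
| "dcpd_X N I \<phi> R T r l = \<phi> (dcpd_Y N I \<phi> R T r l)"
| "dcpd_E N I \<phi> R T r l = tensor_diff N I (dcpd_Y N I \<phi> R T r l) (dcpd_X N I \<phi> R T r l)"
  by pat_completeness auto
termination
  by (relation "inv_image (less_than <*lex*> less_than <*lex*> less_than)
        (\<lambda>x. case x of
           Inl (N, I, \<phi>, R, T, r, l) \<Rightarrow> (l, r, 0)
         | Inr (Inl (N, I, \<phi>, R, T, r, l)) \<Rightarrow> (l, r, 1)
         | Inr (Inr (N, I, \<phi>, R, T, r, l)) \<Rightarrow> (l, r, 2))") auto

declare dcpd_Y.simps [simp del] dcpd_X.simps [simp del] dcpd_E.simps [simp del]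

definition dcpd_residual ::
  "nat \<Rightarrow> (nat \<Rightarrow> nat)
    \<Rightarrow> (((nat \<Rightarrow> nat) \<Rightarrow> 'k::real_normed_field) \<Rightarrow> ((nat \<Rightarrow> nat) \<Rightarrow> 'k))
    \<Rightarrow> nat \<Rightarrow> nat \<Rightarrow> ((nat \<Rightarrow> nat) \<Rightarrow> 'k) \<Rightarrow> real" where
  "dcpd_residual N I \<phi> R l T = frob_norm N I (dcpd_E N I \<phi> R T R l)"

definition dcpd_F ::
  "((nat \<Rightarrow> nat) \<Rightarrow> 'k::real_normed_field) measure \<Rightarrow> nat \<Rightarrow> (nat \<Rightarrow> nat)
    \<Rightarrow> (((nat \<Rightarrow> nat) \<Rightarrow> 'k) \<Rightarrow> ((nat \<Rightarrow> nat) \<Rightarrow> 'k)) \<Rightarrow> nat \<Rightarrow> nat \<Rightarrow> real \<Rightarrow> real" where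
  "dcpd_F M N I \<phi> R L \<beta> =
     measure M {T \<in> space M. \<forall>l\<in>{2..L}.
       sin \<beta> ^ (L - l) * dcpd_residual N I \<phi> R l T
         \<le> sin \<beta> ^ (L - l + 1) * dcpd_residual N I \<phi> R (l - 1) T}"

end

theory Submission
  imports Defs
begin

text \<open>
  At \<open>\<beta> = pi / 2\<close> the event defining \<open>dcpd_F\<close> says that the residual norms do not increase, and
  this holds for every input tensor: for \<open>l \<ge> 2\<close> each step approximates
  \<open>Y[r,l] = X[r,l-1] + E\<close>, where \<open>E\<close> is
  the preceding residual, by a best tensor of rank at most 1. Since \<open>X[r,l-1]\<close> is itself a
  competitor, with error exactly \<open>E\<close>, the new residual is no larger than \<open>E\<close>
  (\<open>dcpd_E_step_le\<close>). Chaining this over one sweep gives \<open>Z\<^sub>l \<le> Z\<^sub>l\<^sub>-\<^sub>1\<close>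
  (\<open>dcpd_residual_antimono_step\<close>), so \<open>F\<^sub>L[pi / 2] = 1\<close>, and left continuity at \<open>pi / 2\<close> provides
  angles below \<open>pi / 2\<close> at which \<open>F\<^sub>L\<close> exceeds any given number less than 1.
\<close>

lemma frob_norm_tensor_diff_add_cancel:
  "frob_norm N I (tensor_diff N I (tensor_add N I X E) X) = frob_norm N I E"
  by (simp add: frob_norm_def tensor_diff_def tensor_add_def cong: L2_set_cong)

lemma tensor_add_in_tensors: "tensor_add N I A B \<in> tensors N I"
  by (auto simp: tensor_add_def tensors_def)

lemma tensor_diff_in_tensors: "tensor_diff N I A B \<in> tensors N I"
  by (auto simp: tensor_diff_def tensors_def)

lemma dcpd_Y_in_tensors:
  assumes "T \<in> tensors N I"
  shows "dcpd_Y N I \<phi> R T r l \<in> tensors N I"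
  using assms by (subst dcpd_Y.simps) (simp add: tensor_add_in_tensors tensor_diff_in_tensors)

lemma dcpd_X_rank_at_most_1:
  assumes "best_rank1_approx N I \<phi>" and "T \<in> tensors N I"
  shows "dcpd_X N I \<phi> R T r l \<in> rank_at_most N I 1"
  using assms dcpd_Y_in_tensors[OF assms(2)]
  by (auto simp: dcpd_X.simps best_rank1_approx_def)

text \<open>The previous rank-1 term competes against the best approximation of its own update, leaving
  the error that was added to it.\<close>

lemma dcpd_E_step_le:
  assumes best: "best_rank1_approx N I \<phi>" and T: "T \<in> tensors N I"
    and Y: "dcpd_Y N I \<phi> R T r l = tensor_add N I (dcpd_X N I \<phi> R T r l') E"
  shows "frob_norm N I (dcpd_E N I \<phi> R T r l) \<le> frob_norm N I E"
proof -
  let ?Y = "dcpd_Y N I \<phi> R T r l" and ?X = "dcpd_X N I \<phi> R T r l'"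
  have "frob_norm N I (dcpd_E N I \<phi> R T r l) = frob_norm N I (tensor_diff N I ?Y (\<phi> ?Y))"
    by (simp add: dcpd_E.simps dcpd_X.simps)
  also have "\<dots> \<le> frob_norm N I (tensor_diff N I ?Y ?X)"
    using best dcpd_Y_in_tensors[OF T] dcpd_X_rank_at_most_1[OF best T]
    unfolding best_rank1_approx_def by blast
  also have "\<dots> = frob_norm N I E"
    by (simp add: Y frob_norm_tensor_diff_add_cancel)
  finally show ?thesis .
qed

lemma dcpd_E_le_previous_sweep:
  assumes best: "best_rank1_approx N I \<phi>" and T: "T \<in> tensors N I"
    and "l \<ge> 2" and "r \<ge> 1"
  shows "frob_norm N I (dcpd_E N I \<phi> R T r l) \<le> frob_norm N I (dcpd_E N I \<phi> R T R (l - 1))"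
  using \<open>r \<ge> 1\<close>
proof (induction r rule: dec_induct)
  case base
  show ?case
    by (rule dcpd_E_step_le[OF best T]) (subst dcpd_Y.simps, use \<open>l \<ge> 2\<close> in simp)
next
  case (step r)
  have "frob_norm N I (dcpd_E N I \<phi> R T (Suc r) l) \<le> frob_norm N I (dcpd_E N I \<phi> R T r l)"
    by (rule dcpd_E_step_le[OF best T])
      (subst dcpd_Y.simps, use \<open>l \<ge> 2\<close> step.hyps in simp)
  with step.IH show ?case by linarith
qed

lemma dcpd_residual_antimono_step:
  assumes "best_rank1_approx N I \<phi>" and "T \<in> tensors N I" and "l \<ge> 2" and "R \<ge> 1"
  shows "dcpd_residual N I \<phi> R l T \<le> dcpd_residual N I \<phi> R (l - 1) T"
  using dcpd_E_le_previous_sweep[OF assms] by (simp add: dcpd_residual_def)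

lemma dcpd_F_pi_half:
  assumes "prob_space M" and space: "space M \<subseteq> tensors N I"
    and "best_rank1_approx N I \<phi>" and "R \<ge> 1"
  shows "dcpd_F M N I \<phi> R L (pi / 2) = 1"
proof -
  have "{T \<in> space M. \<forall>l\<in>{2..L}.
       sin (pi / 2) ^ (L - l) * dcpd_residual N I \<phi> R l T
         \<le> sin (pi / 2) ^ (L - l + 1) * dcpd_residual N I \<phi> R (l - 1) T} = space M"
    using assms by (auto intro!: dcpd_residual_antimono_step[simplified])
  then show ?thesis
    using prob_space.prob_space[OF \<open>prob_space M\<close>] unfolding dcpd_F_def by presburger
qed

theorem propositionV7:
  fixes N R L :: nat and I :: "nat \<Rightarrow> nat"
    and \<phi> :: "((nat \<Rightarrow> nat) \<Rightarrow> 'k::{real_normed_field,euclidean_space}) \<Rightarrow> ((nat \<Rightarrow> nat) \<Rightarrow> 'k)"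
    and M :: "((nat \<Rightarrow> nat) \<Rightarrow> 'k) measure"
    and \<beta>\<^sub>0 :: real
  assumes "N \<ge> 1" and "\<forall>n\<in>{1..N}. I n \<ge> 1" and "R \<ge> 1"
    and "best_rank1_approx N I \<phi>"
    and "prob_space M"
    and "space M = rank_at_most N I R"
    and "sets (restrict_space (PiM (multi_indices N I) (\<lambda>_. borel)) (rank_at_most N I R)) \<subseteq> sets M"
    and "\<forall>l\<ge>1. dcpd_residual N I \<phi> R l \<in> borel_measurable M"
    and "L > 1"
    and "0 \<le> \<beta>\<^sub>0" and "\<beta>\<^sub>0 < pi / 2"
    and "continuous_on {\<beta>\<^sub>0..pi / 2} (dcpd_F M N I \<phi> R L)"
  shows "\<forall>\<epsilon>::real. 0 < \<epsilon> \<and> \<epsilon> \<le> 1 \<longrightarrow>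
           (\<exists>\<beta>. \<beta>\<^sub>0 \<le> \<beta> \<and> \<beta> < pi / 2 \<and> dcpd_F M N I \<phi> R L \<beta> > 1 - \<epsilon>)"
proof (intro allI impI)
  fix \<epsilon> :: real
  assume \<epsilon>: "0 < \<epsilon> \<and> \<epsilon> \<le> 1"
  let ?F = "dcpd_F M N I \<phi> R L"
  have "space M \<subseteq> tensors N I"
    using \<open>space M = rank_at_most N I R\<close> by (auto simp: rank_at_most_def)
  then have F1: "?F (pi / 2) = 1"
    using assms by (intro dcpd_F_pi_half)
  from \<open>continuous_on {\<beta>\<^sub>0..pi / 2} ?F\<close>
  obtain d where d: "d > 0"
    and near: "\<And>\<beta>. \<beta> \<in> {\<beta>\<^sub>0..pi / 2} \<Longrightarrow> dist \<beta> (pi / 2) < d \<Longrightarrow> dist (?F \<beta>) (?F (pi / 2)) < \<epsilon>"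
    using \<epsilon> \<open>\<beta>\<^sub>0 < pi / 2\<close> unfolding continuous_on_iff
    by (metis atLeastAtMost_iff less_eq_real_def)
  define \<beta> where "\<beta> = max \<beta>\<^sub>0 (pi / 2 - d / 2)"
  have \<beta>: "\<beta>\<^sub>0 \<le> \<beta>" "\<beta> < pi / 2" "dist \<beta> (pi / 2) < d"
    using d \<open>\<beta>\<^sub>0 < pi / 2\<close> unfolding \<beta>_def dist_real_def by linarith+
  then have "dist (?F \<beta>) 1 < \<epsilon>"
    using near[of \<beta>] F1 by simp
  then have "?F \<beta> > 1 - \<epsilon>"
    by (simp add: dist_real_def abs_less_iff)
  with \<beta> show "\<exists>\<beta>. \<beta>\<^sub>0 \<le> \<beta> \<and> \<beta> < pi / 2 \<and> ?F \<beta> > 1 - \<epsilon>"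
    by blast
qed

end
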